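(* Assume $\mathrm{add}(\mathcal{N})=\mathfrak{c}$. Then $\mathcal{I}_{\mathbb{FSP}}\setminus\mathcal{N}\ne\emptyset$.
   Context: A tree is a nonempty set $p \subseteq 2^{<\omega}$ closed under initial segments ($\trianglelefteq$ denotes the initial segment relation and $\triangleleft$ its strict version; $|t|$ is the length of $t$). A node $t\in p$ is splitting if both $t^\frown 0, t^\frown 1 \in p$; $\mathrm{Split}(p)$ is the set of splitting nodes. $p$ is perfect if every node of $p$ is extended (not necessarily properly) by a splitting node of $p$. $\mathrm{Lev}_n(p)=\{t\in p: |t|=n\}$, $p\upharpoonright t=\{s\in p : s\trianglelefteq t \text{ or } t\triangleleft s\}$, and $[p]=\{f\in 2^\omega : \forall n\, (f\upharpoonright n\in p)\}$. $\mathbb{FSP}$ (fat splitting tree forcing) is the set of perfect trees $p\subseteq 2^{<\omega}$ such that for every $t\in p$ there is $k\in\omega$ such that for every $n\in\omega$ with $n\ge k-1$ there is $t'\in \mathrm{Lev}_n(p\upharpoonright t)$ with $t'\in\mathrm{Split}(p)$; ordered by $q\le p$ iff $q\subseteq p$. $X\subseteq 2^\omega$ is $\mathbb{FSP}$-nowhere dense if $\forall p\in\mathbb{FSP}\,\exists q\le p\ ([q]\cap X=\emptyset)$; $\mathcal{I}_{\mathbb{FSP}}$ is the $\sigma$-ideal of sets included in a countable union of $\mathbb{FSP}$-nowhere dense sets. $\mathcal{N}$ is the $\sigma$-ideal of measure zero subsets of $2^\omega$ for the standard product measure $\mu$; $\mathrm{add}(\mathcal{N})$ is the least cardinality of a family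 of sets in $\mathcal{N}$ whose union is not in $\mathcal{N}$; $\mathfrak{c}=2^{\aleph_0}$. *)

theory Defs
  imports "HOL-Library.Sublist" "HOL-Probability.Probability"
begin

unbundle cardinal_syntax

text \<open>Finite binary sequences are lists over \<^typ>\<open>bool\<close>, points of Cantor space are functions
  \<^typ>\<open>nat \<Rightarrow> bool\<close>.\<close>

definition tree :: "bool list set \<Rightarrow> bool"
  where "tree p \<longleftrightarrow> p \<noteq> {} \<and> (\<forall>t\<in>p. \<forall>s. prefix s t \<longrightarrow> s \<in> p)"

definition Split :: "bool list set \<Rightarrow> bool list set"
  where "Split p = {t \<in> p. t @ [False] \<in> p \<and> t @ [True] \<in> p}"

definition perfect_tree :: "bool list set \<Rightarrow> bool"
  where "perfect_tree p \<longleftrightarrow> tree p \<and> (\<forall>t\<in>p. \<exists>s\<in>Split p. prefix t s)"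

definition Lev :: "nat \<Rightarrow> bool list set \<Rightarrow> bool list set"
  where "Lev n p = {t \<in> p. length t = n}"

definition tree_restrict :: "bool list set \<Rightarrow> bool list \<Rightarrow> bool list set"
  where "tree_restrict p t = {s \<in> p. prefix s t \<or> strict_prefix t s}"

definition branches :: "bool list set \<Rightarrow> (nat \<Rightarrow> bool) set"
  where "branches p = {f. \<forall>n. map f [0..<n] \<in> p}"

text \<open>The bound on \<open>n\<close> is \<open>n \<ge> k - 1\<close>, written without the truncated subtraction.
  The order of the forcing is inclusion.\<close>

definition FSP :: "bool list set set"
  where "FSP = {p. perfect_tree p \<and>
    (\<forall>t\<in>p. \<exists>k::nat. \<forall>n. n + 1 \<ge> k \<longrightarrow> (\<exists>t'\<in>Lev n (tree_restrict p t). t' \<in> Split p))}"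

definition FSP_nowhere_dense :: "(nat \<Rightarrow> bool) set \<Rightarrow> bool"
  where "FSP_nowhere_dense X \<longleftrightarrow> (\<forall>p\<in>FSP. \<exists>q\<in>FSP. q \<subseteq> p \<and> branches q \<inter> X = {})"

definition I_FSP :: "(nat \<Rightarrow> bool) set set"
  where "I_FSP = {X. \<exists>\<A>. countable \<A> \<and> (\<forall>A\<in>\<A>. FSP_nowhere_dense A) \<and> X \<subseteq> \<Union>\<A>}"

definition cantor_measure :: "(nat \<Rightarrow> bool) measure"
  where "cantor_measure = PiM UNIV (\<lambda>_. uniform_count_measure (UNIV :: bool set))"

text \<open>The completion makes every subset of a Borel null set a null set.\<close>

definition null_ideal :: "(nat \<Rightarrow> bool) set set"
  where "null_ideal = null_sets (completion cantor_measure)"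

text \<open>Cardinals are represented by cardinal orders, compared up to \<open>=o\<close>. The additivity
  of a family \<open>I\<close> of sets is the cardinality of a smallest subfamily whose union is not in \<open>I\<close>;
  the lemma below shows that this is well-defined as soon as some subfamily has this property.
  For the null ideal one such subfamily is the set of all singletons.\<close>

definition additivity :: "'a set set \<Rightarrow> 'a set rel"
  where "additivity I = |SOME \<F>. \<F> \<subseteq> I \<and> \<Union>\<F> \<notin> I \<and>
    (\<forall>\<G>. \<G> \<subseteq> I \<and> \<Union>\<G> \<notin> I \<longrightarrow> |\<F>| \<le>o |\<G>| )|"

lemma additivity_least:
  assumes "\<A> \<subseteq> I" "\<Union>\<A> \<notin> I"
  shows "\<exists>\<F>. \<F> \<subseteq> I \<and> \<Union>\<F> \<notin> I \<and> additivity I = |\<F>|"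
    and "\<And>\<G>. \<G> \<subseteq> I \<Longrightarrow> \<Union>\<G> \<notin> I \<Longrightarrow> additivity I \<le>o |\<G>|"
proof -
  let ?P = "\<lambda>\<F>. \<F> \<subseteq> I \<and> \<Union>\<F> \<notin> I \<and> (\<forall>\<G>. \<G> \<subseteq> I \<and> \<Union>\<G> \<notin> I \<longrightarrow> |\<F>| \<le>o |\<G>| )"
  let ?R = "card_of ` {\<F>. \<F> \<subseteq> I \<and> \<Union>\<F> \<notin> I}"
  have "?R \<noteq> {}" "\<forall>r\<in>?R. Card_order r"
    using assms by (auto simp: card_of_Card_order)
  then have "\<exists>r\<in>?R. \<forall>r'\<in>?R. r \<le>o r'"
    by (rule exists_minim_Card_order)
  then have "\<exists>\<F>. ?P \<F>"
    by auto
  then have *: "?P (SOME \<F>. ?P \<F>)"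
    by (rule someI_ex)
  show "\<exists>\<F>. \<F> \<subseteq> I \<and> \<Union>\<F> \<notin> I \<and> additivity I = |\<F>|"
    using * unfolding additivity_def by blast
  show "additivity I \<le>o |\<G>|" if "\<G> \<subseteq> I" "\<Union>\<G> \<notin> I" for \<G>
    using * that unfolding additivity_def by blast
qed

abbreviation continuum :: "(nat \<Rightarrow> bool) rel"
  where "continuum \<equiv> ctwo ^c natLeq"

end

theory Submission imports Defs begin

text \<open>
  The set outside the null ideal is a Sierpinski-type set, built by diagonalizing along a
  well-order of length \<open>\<cc>\<close> of the points of Cantor space. These points also index the trees
  \<open>p\<^sub>a\<close> in \<^const>\<open>FSP\<close> and a cofinal family of null sets \<open>G\<^sub>a\<close>
  (\<open>null_sets_coded\<close>). Suppose that each \<open>p\<^sub>a\<close> has a subtree \<open>q\<^sub>a\<close> in \<^const>\<open>FSP\<close> with a null set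
  of branches. By the assumption on the additivity, \<open>G\<^sub>a\<close> and the branches of all \<open>q\<^sub>b\<close> with
  \<open>b \<le> a\<close> together form a null set, so there is a point \<open>x\<^sub>a\<close> outside of it. The set \<open>X\<close> of these
  points lies in no \<open>G\<^sub>a\<close>, so it is not null, and it meets the branches of each \<open>q\<^sub>a\<close> in fewer
  than \<open>\<cc>\<close> points. To see that \<open>X\<close> is nowhere dense it remains to shrink \<open>q\<^sub>a\<close> so
  that the branches avoid these few points.

  Both shrinkings come from one fact (\<open>FSP_disjoint_subtrees\<close>): every tree in \<^const>\<open>FSP\<close>
  has continuum many subtrees in \<^const>\<open>FSP\<close> whose sets of branches are pairwise disjoint. Since
  only countably many disjoint sets can have positive measure, one of them is null; since fewer
  than \<open>\<cc>\<close> points meet fewer than \<open>\<cc>\<close> disjoint sets, one of them avoids the points.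

  The subtrees are the fibres of a continuous map from the branches of \<open>p\<close> to Cantor space. The
  levels are cut into blocks so long that every branch passes a splitting node in each block, and
  the direction that it takes at the first of them is its digit at this block. The digits
  can be prescribed freely (\<open>exists_branch_digits\<close>). The splitting nodes at a given level \<open>m\<close>, on
  the other hand, may be reachable only with uncontrolled digits in the block of \<open>m\<close> and in the
  one before. The map therefore reads the digits redundantly: each bit of the value is written in
  two possible places, and a third digit says which of the two is read. Whatever two adjacent
  digits are spoiled, the others can be chosen to give the desired value (\<open>code_eqI\<close>). So in
  each fibre there are splitting nodes at almost all levels above each node (\<open>fibre_FSP\<close>).
\<close>

section \<open>Trees and their branches\<close>

abbreviation init :: "(nat \<Rightarrow> bool) \<Rightarrow> nat \<Rightarrow> bool list"
  where "init x n \<equiv> map x [0..<n]"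

lemma init_eq_mono:
  assumes "init x n = init y n" "m \<le> n"
  shows "init x m = init y m"
  using assms by auto

lemma take_init [simp]: "take m (init x n) = init x (min m n)"
  by (simp add: take_map min_def)

lemma prefix_init: "m \<le> n \<Longrightarrow> prefix (init x m) (init x n)"
  by (metis min.absorb1 take_init take_is_prefix)

lemma prefix_eq_init:
  assumes "prefix s (init x n)"
  shows "s = init x (length s)" "length s \<le> n"
proof -
  show le: "length s \<le> n"
    using prefix_length_le[OF assms] by simp
  have "s = take (length s) (init x n)"
    using assms by (auto simp: prefix_def append_eq_conv_conj simp del: take_init)
  then show "s = init x (length s)"
    using le by simp
qed

lemma init_eq_if_prefix:
  assumes "prefix u s" "init x (length s) = s"
  shows "init x (length u) = u"
  using assms prefix_eq_init(1)[of u x "length s"] by simp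

lemma tree_prefix: "tree p \<Longrightarrow> t \<in> p \<Longrightarrow> prefix s t \<Longrightarrow> s \<in> p"
  unfolding tree_def by blast

lemma init_in_tree: "x \<in> branches p \<Longrightarrow> init x n \<in> p"
  unfolding branches_def by blast

text \<open>Fat splitting already yields perfectness, and above a node \<open>t\<close> the nodes of
  \<^term>\<open>tree_restrict p t\<close> at levels beyond \<open>length t\<close> are the extensions of \<open>t\<close>. This form avoids
  both notions.\<close>
lemma FSP_iff:
  "p \<in> FSP \<longleftrightarrow> tree p \<and> (\<forall>t\<in>p. \<exists>k. \<forall>m\<ge>k. \<exists>s\<in>Split p. prefix t s \<and> length s = m)"
    (is "_ \<longleftrightarrow> _ \<and> ?fat")
proof
  assume p: "p \<in> FSP"
  have "\<exists>k. \<forall>m\<ge>k. \<exists>s\<in>Split p. prefix t s \<and> length s = m" if "t \<in> p" for t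
  proof -
    obtain k where k: "\<And>m. k \<le> m + 1 \<Longrightarrow> \<exists>t'\<in>Lev m (tree_restrict p t). t' \<in> Split p"
      using p \<open>t \<in> p\<close> unfolding FSP_def by blast
    have "\<exists>s\<in>Split p. prefix t s \<and> length s = m" if m: "max k (length t) \<le> m" for m
    proof -
      obtain s where "s \<in> Split p" "length s = m" "prefix s t \<or> strict_prefix t s"
        using k[of m] m unfolding Lev_def tree_restrict_def by auto
      moreover from this have "prefix t s"
        using m by (auto simp: prefix_def strict_prefix_def)
      ultimately show ?thesis by blast
    qed
    then show ?thesis by blast
  qed
  then show "tree p \<and> ?fat"
    using p unfolding FSP_def perfect_tree_def by blast
next
  assume p: "tree p \<and> ?fat"
  have "\<exists>k::nat. \<forall>n. n + 1 \<ge> k \<longrightarrow> (\<exists>t'\<in>Lev n (tree_restrict p t). t' \<in> Split p)" if "t \<in> p" for t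
  proof -
    obtain k where k: "\<And>m. k \<le> m \<Longrightarrow> \<exists>s\<in>Split p. prefix t s \<and> length s = m"
      using conjunct2[OF p, rule_format, OF \<open>t \<in> p\<close>] by blast
    have "\<exists>t'\<in>Lev n (tree_restrict p t). t' \<in> Split p" if n: "n + 1 \<ge> Suc k" for n
    proof -
      obtain s where "s \<in> Split p" "prefix t s" "length s = n"
        using k[of n] n by auto
      then show ?thesis
        unfolding Lev_def tree_restrict_def Split_def strict_prefix_def by blast
    qed
    then show ?thesis by blast
  qed
  moreover have "perfect_tree p"
    using p unfolding perfect_tree_def by blast
  ultimately show "p \<in> FSP"
    unfolding FSP_def by blast
qed

lemma FSP_pruned:
  assumes "p \<in> FSP" "t \<in> p"
  shows "\<exists>b. t @ [b] \<in> p"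
proof -
  obtain k where "\<And>m. k \<le> m \<Longrightarrow> \<exists>s\<in>Split p. prefix t s \<and> length s = m"
    using assms unfolding FSP_iff by blast
  then obtain s where s: "s \<in> Split p" "prefix t s" "length s = Suc (k + length t)"
    using le_add1[of k "length t"] le_SucI[of k "k + length t"] by blast
  then obtain r where r: "s = t @ r"
    by (auto simp: prefix_def)
  with s(3) obtain b r' where "r = b # r'"
    by (cases r) auto
  with r have "s = t @ b # r'" by simp
  then have "prefix (t @ [b]) s" by simp
  then show ?thesis
    using s assms unfolding FSP_iff Split_def by (blast intro: tree_prefix)
qed

text \<open>A branch can be built node by node: there is a choice only at splitting nodes, and there
  it is dictated by \<open>c\<close>.\<close>
lemma exists_steered_branch:
  assumes "p \<in> FSP" "u \<in> p"
  obtains y where "y \<in> branches p" "init y (length u) = u"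
    "\<And>n. length u \<le> n \<Longrightarrow> init y n \<in> Split p \<Longrightarrow> y n = c n"
proof -
  define choice where "choice t = (if t \<in> Split p then c (length t) else t @ [True] \<in> p)" for t
  define node where "node = rec_nat u (\<lambda>_ t. t @ [choice t])"
  have node_simps [simp]: "node 0 = u" "node (Suc n) = node n @ [choice (node n)]" for n
    by (simp_all add: node_def)
  have len [simp]: "length (node n) = length u + n" for n
    by (induction n) auto
  have mem: "node n \<in> p" for n
  proof (induction n)
    case (Suc n)
    obtain b where "node n @ [b] \<in> p"
      using FSP_pruned[OF assms(1) Suc] by blast
    then show ?case
      using Suc by (cases b; cases "c (length u + n)") (auto simp: choice_def Split_def)
  qed (simp add: assms)
  have nth: "node n ! i = node m ! i" if "m \<le> n" "i < length u + m" for i m n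
    using that by (induction n rule: dec_induct) (auto simp: nth_append)
  \<comment> \<open>\<open>node (Suc i)\<close> is long enough to have an entry \<open>i\<close>, even if \<open>u\<close> is empty.\<close>
  define y where "y i = node (Suc i) ! i" for i
  have init_y: "init y (length u + n) = node n" for n
  proof (rule nth_equalityI)
    fix i assume "i < length (init y (length u + n))"
    then show "init y (length u + n) ! i = node n ! i"
      using nth[of "Suc i" "max (Suc i) n" i] nth[of n "max (Suc i) n" i]
      by (simp add: y_def del: node_simps)
  qed simp
  have "init y n \<in> p" for n
    using tree_prefix[OF _ mem[of n]] assms(1) prefix_init[of n "length u + n" y] init_y[of n]
    unfolding FSP_iff by simp
  then have "y \<in> branches p"
    by (simp add: branches_def)
  moreover have "init y (length u) = u"
    using init_y[of 0] by simp
  moreover have "y n = c n" if "length u \<le> n" "init y n \<in> Split p" for n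
  proof -
    obtain i where n: "n = length u + i"
      using \<open>length u \<le> n\<close> le_Suc_ex by blast
    then have "init y n @ [y n] = init y n @ [choice (init y n)]"
      using init_y[of "Suc i"] init_y[of i] by simp
    then show ?thesis
      using that(2) by (simp add: choice_def)
  qed
  ultimately show thesis
    using that by blast
qed

section \<open>Continuum many subtrees with disjoint branches\<close>

text \<open>There are only finitely many nodes at each level, so a common bound exists from which on
  they all have splitting extensions at every level. Starting from \<open>l (Suc i) - 1\<close>
  puts one of these levels into the block \<open>{l i..<l (Suc i)}\<close> itself.\<close>
lemma exists_fat_levels:
  assumes "p \<in> FSP"
  obtains l :: "nat \<Rightarrow> nat" where "strict_mono l" "l 0 = 0"
    "\<And>i u m. u \<in> p \<Longrightarrow> length u = l i \<Longrightarrow> l (Suc i) \<le> Suc m \<Longrightarrow>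
      \<exists>s\<in>Split p. prefix u s \<and> length s = m"
proof -
  have "\<forall>t\<in>p. \<exists>k. \<forall>m\<ge>k. \<exists>s\<in>Split p. prefix t s \<and> length s = m"
    using assms unfolding FSP_iff by blast
  then obtain k where k: "\<And>t m. t \<in> p \<Longrightarrow> k t \<le> m \<Longrightarrow> \<exists>s\<in>Split p. prefix t s \<and> length s = m"
    by metis
  define next_level where "next_level n = Suc (n + (\<Sum>t | length t = n. k t))" for n
  define l where "l = rec_nat 0 (\<lambda>_. next_level)"
  have l_Suc: "l (Suc i) = next_level (l i)" for i
    by (simp add: l_def)
  show thesis
  proof
    show "strict_mono l"
      by (simp add: strict_mono_Suc_iff l_Suc next_level_def)
    show "l 0 = 0"
      by (simp add: l_def)
    fix i u m assume u: "u \<in> p" "length u = l i" "l (Suc i) \<le> Suc m"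
    have "finite {t :: bool list. length t = l i}"
      using finite_lists_length_eq[of "UNIV :: bool set"] by simp
    then have "k u \<le> (\<Sum>t | length t = l i. k t)"
      using u(2) by (intro member_le_sum) auto
    then show "\<exists>s\<in>Split p. prefix u s \<and> length s = m"
      using k u unfolding l_Suc next_level_def by simp
  qed
qed

locale fat_levels =
  fixes p :: "bool list set" and l :: "nat \<Rightarrow> nat"
  assumes p: "p \<in> FSP"
    and l: "strict_mono l" "l 0 = 0"
    and fat: "\<And>i u m. u \<in> p \<Longrightarrow> length u = l i \<Longrightarrow> l (Suc i) \<le> Suc m \<Longrightarrow>
      \<exists>s\<in>Split p. prefix u s \<and> length s = m"
begin

lemmas l_mono = strict_mono_less_eq[OF l(1)]

definition block :: "nat \<Rightarrow> nat"
  where "block n = (LEAST i. n < l (Suc i))"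

lemma block: "l (block n) \<le> n" "n < l (Suc (block n))"
proof -
  have "n < l (Suc n)"
    using strict_mono_imp_increasing[OF l(1), of "Suc n"] by simp
  then show "n < l (Suc (block n))"
    unfolding block_def by (rule LeastI[where P = "\<lambda>i. n < l (Suc i)"])
  show "l (block n) \<le> n"
  proof (cases "block n")
    case (Suc i)
    then show ?thesis
      using not_less_Least[of i "\<lambda>i. n < l (Suc i)"] unfolding block_def by simp
  qed (simp add: l)
qed

lemma block_eqI: "l i \<le> n \<Longrightarrow> n < l (Suc i) \<Longrightarrow> block n = i"
  using block[of n] strict_mono_less[OF l(1), of i "Suc (block n)"]
    strict_mono_less[OF l(1), of "block n" "Suc i"] by simp

definition split_level :: "(nat \<Rightarrow> bool) \<Rightarrow> nat \<Rightarrow> nat"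
  where "split_level x i = (LEAST n. l i \<le> n \<and> init x n \<in> Split p)"

definition digit :: "(nat \<Rightarrow> bool) \<Rightarrow> nat \<Rightarrow> bool"
  where "digit x i = x (split_level x i)"

text \<open>Some extension \<open>s\<close> of the node at level \<open>l i\<close> splits within the block. A branch that does
  not split in the block never gets the chance to leave \<open>s\<close>, so it would have to pass through \<open>s\<close>
  itself.\<close>
lemma exists_split_in_block:
  assumes x: "x \<in> branches p"
  shows "\<exists>n. l i \<le> n \<and> n < l (Suc i) \<and> init x n \<in> Split p"
proof (rule ccontr)
  assume contra: "\<not> ?thesis"
  have less: "l i < l (Suc i)"
    using l(1) by (simp add: strict_mono_Suc_iff)
  then obtain s where s: "s \<in> Split p" "prefix (init x (l i)) s" "length s = l (Suc i) - 1"
    using fat[of "init x (l i)" i "l (Suc i) - 1"] init_in_tree[OF x] by auto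
  have "init x n = take n s" if "l i \<le> n" "n \<le> length s" for n
    using that
  proof (induction n rule: dec_induct)
    case base
    then show ?case
      using s(2) by (auto simp: prefix_def)
  next
    case (step n)
    have "take n s @ [s ! n] \<in> p"
      using step s(1) p tree_prefix[of p s "take (Suc n) s"] take_is_prefix[of "Suc n" s]
      unfolding FSP_iff Split_def by (simp add: take_Suc_conv_app_nth)
    moreover have "take n s @ [x n] \<in> p"
      using init_in_tree[OF x, of "Suc n"] step by simp
    moreover have "init x n \<notin> Split p"
    proof -
      have "n < l (Suc i)"
        using step.prems s(3) by simp
      then show ?thesis
        using contra step.hyps(1) by blast
    qed
    moreover have "init x n \<in> p"
      by (rule init_in_tree[OF x])
    ultimately have "s ! n = x n"
      using step unfolding Split_def by (cases "s ! n"; cases "x n") auto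
    then show ?case
      using step by (simp add: take_Suc_conv_app_nth)
  qed
  from this[of "length s"] have "init x (l (Suc i) - 1) \<in> Split p"
    using s less by simp
  then show False
    using contra less by (metis Suc_pred' less_Suc_eq_le lessI not_less_zero zero_less_iff_neq_zero)
qed

lemma split_level:
  assumes "x \<in> branches p"
  shows "l i \<le> split_level x i" "split_level x i < l (Suc i)" "init x (split_level x i) \<in> Split p"
proof -
  obtain n where n: "l i \<le> n \<and> init x n \<in> Split p" "n < l (Suc i)"
    using exists_split_in_block[OF assms] by blast
  have "l i \<le> split_level x i \<and> init x (split_level x i) \<in> Split p"
    unfolding split_level_def using n(1) by (rule LeastI)
  moreover have "split_level x i \<le> n"
    unfolding split_level_def using n(1) by (rule Least_le)
  ultimately show "l i \<le> split_level x i" "split_level x i < l (Suc i)"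
    "init x (split_level x i) \<in> Split p"
    using n(2) by auto
qed

text \<open>A digit is determined by the part of the branch up to the end of its block. This is the
  continuity which makes the fibres of \<open>code\<close> below closed.\<close>
lemma digit_cong:
  assumes x: "x \<in> branches p" and y: "y \<in> branches p"
    and eq: "init x n = init y n" and "l (Suc i) \<le> n"
  shows "digit x i = digit y i"
proof -
  have le: "split_level z i \<le> split_level x i"
    if "x \<in> branches p" "z \<in> branches p" "init x n = init z n" for x z
  proof -
    have "init z (split_level x i) = init x (split_level x i)"
      using init_eq_mono[OF that(3)] split_level(2)[OF that(1), of i] \<open>l (Suc i) \<le> n\<close> by auto
    then have "l i \<le> split_level x i \<and> init z (split_level x i) \<in> Split p"
      using split_level[OF that(1), of i] by (simp del: map_eq_conv)
    then show ?thesis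
      unfolding split_level_def[of z] by (rule Least_le)
  qed
  have "split_level x i = split_level y i"
    using le[OF x y eq] le[OF y x eq[symmetric]] by simp
  moreover have "split_level x i < n"
    using split_level(2)[OF x, of i] \<open>l (Suc i) \<le> n\<close> by simp
  ultimately show ?thesis
    using eq unfolding digit_def by auto
qed

lemma exists_branch_digits:
  assumes "u \<in> p" "length u = l j"
  obtains y where "y \<in> branches p" "init y (l j) = u" "\<And>i. j \<le> i \<Longrightarrow> digit y i = b i"
proof -
  obtain y where y: "y \<in> branches p" "init y (length u) = u"
    "\<And>n. length u \<le> n \<Longrightarrow> init y n \<in> Split p \<Longrightarrow> y n = b (block n)"
    using exists_steered_branch[OF p assms(1), of "\<lambda>n. b (block n)"] by blast
  have "digit y i = b i" if "j \<le> i" for i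
  proof -
    have "length u \<le> split_level y i"
      using split_level(1)[OF y(1), of i] l_mono[of j i] that assms(2) by simp
    moreover have "block (split_level y i) = i"
      using split_level[OF y(1)] by (intro block_eqI)
    ultimately show ?thesis
      using y(3) split_level(3)[OF y(1)] unfolding digit_def by metis
  qed
  then show thesis
    using that y assms(2) by metis
qed

text \<open>The digit at \<open>5 * k\<close> selects the place from which the bit \<open>k\<close> is read. The positions are
  chosen such that no two of the three digits that concern a bit are adjacent.\<close>

definition code :: "(nat \<Rightarrow> bool) \<Rightarrow> nat \<Rightarrow> bool"
  where "code x k = (if digit x (5 * k) then digit x (5 * k + 4) else digit x (5 * k + 2))"

lemma code_cong:
  assumes "x \<in> branches p" "y \<in> branches p" "init x n = init y n" "l (5 * k + 5) \<le> n"
  shows "code x k = code y k"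
proof -
  have "digit x i = digit y i" if "i < 5 * k + 5" for i
    using that assms(4) l_mono[of "Suc i" "5 * k + 5"] by (intro digit_cong[OF assms(1-3)]) simp
  then show ?thesis
    by (simp add: code_def)
qed

text \<open>The digits to prescribe when those in the blocks \<open>j\<close> and \<open>Suc j\<close> cannot be controlled: the
  value \<open>f\<close> is written in both places, and the selectors point to a place that is not spoiled.
  All selectors can be equal, because at most one bit has a spoiled place.\<close>

definition guide :: "nat \<Rightarrow> (nat \<Rightarrow> bool) \<Rightarrow> nat \<Rightarrow> bool"
  where "guide j f i = (if i mod 5 = 0 then j mod 5 \<le> 2 else f (i div 5))"

text \<open>At most one of the three digits that concern the bit \<open>k\<close> is spoiled. If it is the selector,
  both places contain \<open>f k\<close>, and it does not matter which one is read. If it is one of the places,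
  the selector points to the other one.\<close>
lemma code_eqI:
  assumes "\<And>i. 5 * k \<le> i \<Longrightarrow> i \<noteq> j \<Longrightarrow> i \<noteq> Suc j \<Longrightarrow> digit y i = guide j f i"
  shows "code y k = f k"
proof -
  have b0: "guide j f (5 * k) = (j mod 5 \<le> 2)"
    by (simp add: guide_def)
  have b24: "guide j f (5 * k + 2) = f k" "guide j f (5 * k + 4) = f k"
  proof -
    have "(5 * k + 2) mod 5 = 2" "(5 * k + 4) mod 5 = 4"
      "(5 * k + 2) div 5 = k" "(5 * k + 4) div 5 = k"
      by presburger+
    then show "guide j f (5 * k + 2) = f k" "guide j f (5 * k + 4) = f k"
      by (simp_all add: guide_def)
  qed
  have d: "digit y (5 * k + r) = guide j f (5 * k + r)" if "5 * k + r \<noteq> j" "5 * k + r \<noteq> Suc j" for r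
    using assms[of "5 * k + r"] that by simp
  consider "j = 5 * k + 1 \<or> j = 5 * k + 2" | "j = 5 * k + 3 \<or> j = 5 * k + 4"
    | "j \<le> 5 * k \<or> 5 * k + 5 \<le> j"
    by linarith
  then show ?thesis
  proof cases
    case 1
    then have "j mod 5 \<le> 2"
      by (elim disjE) presburger+
    then show ?thesis
      using 1 d[of 0] d[of 4] b0 b24 by (auto simp: code_def)
  next
    case 2
    then have "\<not> j mod 5 \<le> 2"
      by (elim disjE) presburger+
    then show ?thesis
      using 2 d[of 0] d[of 2] b0 b24 by (auto simp: code_def)
  next
    case 3
    then show ?thesis
      using d[of 2] d[of 4] b24 by (auto simp: code_def)
  qed
qed

definition fibre :: "(nat \<Rightarrow> bool) \<Rightarrow> bool list set"
  where "fibre f = {init x n | x n. x \<in> branches p \<and> code x = f}"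

lemma fibre_subset: "fibre f \<subseteq> p"
  unfolding fibre_def by (auto intro: init_in_tree)

lemma branches_fibre:
  assumes x: "x \<in> branches (fibre f)"
  shows "code x = f"
proof
  fix k
  let ?n = "l (5 * k + 5)"
  obtain y m where y: "init x ?n = init y m" "y \<in> branches p" "code y = f"
    using init_in_tree[OF x, of ?n] unfolding fibre_def by blast
  moreover have "m = ?n"
  proof -
    have "length (init x ?n) = length (init y m)"
      using y(1) by (rule arg_cong)
    then show ?thesis by simp
  qed
  moreover have "x \<in> branches p"
    using x fibre_subset[of f] unfolding branches_def by auto
  ultimately have "code x k = code y k"
    by (intro code_cong[of x y ?n]) auto
  then show "code x k = f k"
    using y by simp
qed

lemma tree_fibre: "tree (fibre f)"
proof -
  have "[] \<in> p"
    using p unfolding FSP_iff tree_def by (metis Nil_prefix ex_in_conv)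
  then obtain x where x: "x \<in> branches p" "\<And>i. digit x i = guide 0 f i"
    using exists_branch_digits[of "[]" 0 "guide 0 f"] l(2) by auto
  then have "code x = f"
    by (intro ext code_eqI[of _ 0]) simp
  then have "fibre f \<noteq> {}"
    using x(1) unfolding fibre_def by blast
  moreover have "s \<in> fibre f" if "t \<in> fibre f" "prefix s t" for s t
    using that prefix_eq_init(1) unfolding fibre_def by blast
  ultimately show ?thesis
    unfolding tree_def by blast
qed

text \<open>Given a node \<open>t\<close> of the fibre and a level \<open>m\<close> in the block \<open>Suc j\<close>, follow a branch through
  \<open>t\<close> with the guiding digits up to the start of the block \<open>j\<close>. From there a splitting node \<open>s\<close> of
  \<open>p\<close> at level \<open>m\<close> can be reached, at the price of unknown digits in the blocks \<open>j\<close> and \<open>Suc j\<close>. Both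
  children of \<open>s\<close> extend to branches which follow the guiding digits again after that, and by
  redundancy these branches have the right code.\<close>
lemma fibre_FSP: "fibre f \<in> FSP"
proof -
  have "\<exists>k. \<forall>m\<ge>k. \<exists>s\<in>Split (fibre f). prefix t s \<and> length s = m" if t: "t \<in> fibre f" for t
  proof -
    obtain x n where x: "x \<in> branches p" "code x = f" and t_eq: "t = init x n"
      using t unfolding fibre_def by blast
    have n_le: "n \<le> l (5 * n)"
      using strict_mono_imp_increasing[OF l(1), of "5 * n"] by simp
    \<comment> \<open>The bits below \<open>n\<close> are taken over from \<open>x\<close>, which agrees with the new branches up to level
        \<open>l (5 * n)\<close>. The additional block makes room for the block \<open>j\<close>.\<close>
    have "\<exists>s\<in>Split (fibre f). prefix t s \<and> length s = m" if m: "l (5 * n + 1) \<le> m" for m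
    proof -
      have "l (5 * n + 1) < l (Suc (block m))"
        using block(2)[of m] m by simp
      then have "5 * n + 1 \<le> block m"
        using strict_mono_less[OF l(1)] by simp
      then obtain j where j: "block m = Suc j" "5 * n \<le> j"
        by (cases "block m") auto
      have lm: "l (Suc j) \<le> m" "m < l (Suc (Suc j))"
        using block[of m] j by simp_all
      obtain y0 where y0: "y0 \<in> branches p" "init y0 (l (5 * n)) = init x (l (5 * n))"
          "\<And>i. 5 * n \<le> i \<Longrightarrow> digit y0 i = guide j f i"
        using exists_branch_digits[of "init x (l (5 * n))" "5 * n" "guide j f"] init_in_tree[OF x(1)] by auto
      obtain s where s: "s \<in> Split p" "prefix (init y0 (l j)) s" "length s = m"
        using fat[of "init y0 (l j)" j m] lm init_in_tree[OF y0(1)] by auto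
      have branch: "\<exists>y. y \<in> branches p \<and> code y = f \<and> init y (Suc m) = s @ [d]" for d
      proof -
        have sd: "s @ [d] \<in> p"
          using s(1) unfolding Split_def by (cases d) auto
        obtain z where z: "z \<in> branches p" "init z (length (s @ [d])) = s @ [d]"
          using exists_steered_branch[OF p sd] by blast
        obtain y where y: "y \<in> branches p" "init y (l (Suc (Suc j))) = init z (l (Suc (Suc j)))"
          "\<And>i. Suc (Suc j) \<le> i \<Longrightarrow> digit y i = guide j f i"
          using exists_branch_digits[of "init z (l (Suc (Suc j)))" "Suc (Suc j)" "guide j f"]
            init_in_tree[OF z(1)] by auto
        have y_s: "init y (Suc m) = s @ [d]"
          using init_eq_mono[OF y(2), of "Suc m"] z(2) lm(2) s(3) by (simp del: map_eq_conv upt_Suc)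
        have y_y0: "init y (l j) = init y0 (l j)"
          using init_eq_if_prefix[of "init y0 (l j)" "s @ [d]" y] s y_s by simp
        have y_x: "init y (l (5 * n)) = init x (l (5 * n))"
          using init_eq_mono[OF y_y0, of "l (5 * n)"] y0(2) l_mono j(2) by simp
        have digit_y: "digit y i = guide j f i" if "5 * n \<le> i" "i \<noteq> j" "i \<noteq> Suc j" for i
        proof (cases "i < j")
          case True
          then have "digit y i = digit y0 i"
            using l_mono by (intro digit_cong[OF y(1) y0(1) y_y0]) simp
          then show ?thesis
            using y0(3) that by simp
        qed (use that y(3) in simp)
        have "code y k = f k" for k
        proof (cases "k < n")
          case True
          then have "code y k = code x k"
            using l_mono by (intro code_cong[OF y(1) x(1) y_x]) simp
          then show ?thesis
            using x(2) by simp
        next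
          case False
          then show ?thesis
            using digit_y by (intro code_eqI[of k j y f]) simp
        qed
        then show ?thesis
          using y(1) y_s by blast
      qed
      have sd: "s @ [d] \<in> fibre f" for d
        using branch[of d] unfolding fibre_def by (metis (mono_tags, lifting) mem_Collect_eq)
      then have "s \<in> fibre f"
        using tree_prefix[OF tree_fibre, of "s @ [True]" f s] by simp
      then have "s \<in> Split (fibre f)"
        using sd unfolding Split_def by simp
      moreover have "prefix t s"
      proof -
        have "prefix (init y0 n) s"
          using s(2) prefix_init[of n "l j" y0] n_le l_mono[of "5 * n" j] j(2)
          by (meson le_trans prefix_order.order_trans)
        then show ?thesis
          using init_eq_mono[OF y0(2) n_le] t_eq by simp
      qed
      ultimately show ?thesis
        using s(3) by blast
    qed
    then show ?thesis by blast
  qed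
  then show ?thesis
    using tree_fibre unfolding FSP_iff by blast
qed

end

theorem FSP_disjoint_subtrees:
  assumes "p \<in> FSP"
  obtains Q :: "(nat \<Rightarrow> bool) \<Rightarrow> bool list set"
  where "\<And>f. Q f \<in> FSP" "\<And>f. Q f \<subseteq> p" "disjoint_family (\<lambda>f. branches (Q f))"
proof -
  obtain l where "fat_levels p l"
    using exists_fat_levels[OF assms] assms unfolding fat_levels_def by metis
  then interpret fat_levels p l .
  have "disjoint_family (\<lambda>f. branches (fibre f))"
    unfolding disjoint_family_on_def using branches_fibre by blast
  then show thesis
    using that fibre_FSP fibre_subset by blast
qed

section \<open>Null sets in Cantor space\<close>

lemma space_cantor [simp]: "space cantor_measure = UNIV"
  by (simp add: cantor_measure_def space_PiM PiE_UNIV_domain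
      space_uniform_count_measure)

lemma sets_cantor: "sets cantor_measure = sets (PiM UNIV (\<lambda>_. count_space UNIV))"
  unfolding cantor_measure_def by (intro sets_PiM_cong) (auto simp: sets_uniform_count_measure)

interpretation cantor: prob_space cantor_measure
  unfolding cantor_measure_def
  by (intro prob_space_PiM prob_space_uniform_count_measure) auto

lemma coordinate_measurable [measurable]: "(\<lambda>x. x i) \<in> cantor_measure \<rightarrow>\<^sub>M count_space UNIV"
  by (subst measurable_cong_sets[OF sets_cantor refl]) measurable

lemma null_ideal_iff: "A \<in> null_ideal \<longleftrightarrow> (\<exists>N\<in>null_sets cantor_measure. A \<subseteq> N)"
  by (simp add: null_ideal_def null_sets_completion_iff2)

lemma null_ideal_Un: "A \<in> null_ideal \<Longrightarrow> B \<in> null_ideal \<Longrightarrow> A \<union> B \<in> null_ideal"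
  unfolding null_ideal_def by (rule null_sets.Un)

lemma UNIV_not_null: "UNIV \<notin> null_ideal"
  using cantor.emeasure_space_1 by (auto simp: null_ideal_iff null_sets_def top_unique)

lemma branches_measurable: "branches q \<in> sets cantor_measure"
proof -
  have "init x n \<in> q \<longleftrightarrow> (\<exists>t\<in>{t\<in>q. length t = n}. \<forall>i<n. x i = t ! i)" for x n
  proof
    assume "init x n \<in> q"
    then show "\<exists>t\<in>{t\<in>q. length t = n}. \<forall>i<n. x i = t ! i"
      by (intro bexI[of _ "init x n"]) auto
  next
    assume "\<exists>t\<in>{t\<in>q. length t = n}. \<forall>i<n. x i = t ! i"
    then obtain t where t: "t \<in> q" "length t = n" "\<forall>i<n. x i = t ! i"
      by blast
    then have "init x n = t"
      by (intro nth_equalityI) auto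
    then show "init x n \<in> q"
      using t(1) by simp
  qed
  then have "branches q =
      (\<Inter>n. \<Union>t\<in>{t\<in>q. length t = n}. {x \<in> space cantor_measure. \<forall>i<n. x i = t ! i})"
    by (auto simp: branches_def)
  also have "\<dots> \<in> sets cantor_measure"
    by (intro sets.countable_INT sets.countable_UN' image_subsetI) measurable
  finally show ?thesis .
qed

text \<open>The measures of disjoint sets have a finite sum, so all but countably many of them
  vanish.\<close>

lemma disjoint_branches_null:
  fixes Q :: "(nat \<Rightarrow> bool) \<Rightarrow> bool list set"
  assumes "disjoint_family (\<lambda>f. branches (Q f))"
  shows "\<exists>f. branches (Q f) \<in> null_ideal"
proof (rule ccontr)
  assume contra: "\<not> ?thesis"
  define \<mu> where "\<mu> f = measure cantor_measure (branches (Q f))" for f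
  have pos: "\<mu> f \<noteq> 0" for f
  proof
    assume "\<mu> f = 0"
    then have "branches (Q f) \<in> null_sets cantor_measure"
      using branches_measurable by (simp add: \<mu>_def null_sets_def cantor.emeasure_eq_measure)
    then show False
      using contra null_ideal_iff by blast
  qed
  have "\<mu> summable_on UNIV"
  proof (rule nonneg_bdd_above_summable_on)
    show "bdd_above (sum \<mu> ` {F. F \<subseteq> UNIV \<and> finite F})"
    proof (rule bdd_aboveI2)
      fix F assume "F \<in> {F. F \<subseteq> (UNIV :: (nat \<Rightarrow> bool) set) \<and> finite F}"
      then have "sum \<mu> F = measure cantor_measure (\<Union>f\<in>F. branches (Q f))"
        unfolding \<mu>_def using assms branches_measurable
        by (intro cantor.finite_measure_finite_Union[symmetric])
           (auto simp: disjoint_family_on_def)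
      then show "sum \<mu> F \<le> 1"
        by simp
    qed
  qed (simp add: \<mu>_def)
  then have "countable {f \<in> UNIV. \<mu> f \<noteq> 0}"
    by (rule summable_countable_real)
  then have "countable (UNIV :: (nat \<Rightarrow> bool) set)"
    using pos by simp
  then obtain g :: "nat \<Rightarrow> nat \<Rightarrow> bool" where g: "range g = UNIV"
    using uncountable_def[of "UNIV :: (nat \<Rightarrow> bool) set"] by blast
  then obtain k where "(\<lambda>n. \<not> g n n) = g k"
    by (metis rangeE UNIV_I)
  from fun_cong[OF this, of k] show False
    by simp
qed

text \<open>Outer regularity is a property of finite Borel measures on Polish spaces. It is transferred
  from the product of real lines, into which Cantor space embeds. The embedding has a measurable
  left inverse, so each measurable set is the preimage of a Borel set.\<close>

definition real_digits :: "(nat \<Rightarrow> bool) \<Rightarrow> nat \<Rightarrow> real"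
  where "real_digits x n = of_bool (x n)"

lemma real_digits_measurable: "real_digits \<in> cantor_measure \<rightarrow>\<^sub>M borel"
proof (rule measurable_coordinatewise_then_product)
  fix n
  show "(\<lambda>x. real_digits x n) \<in> cantor_measure \<rightarrow>\<^sub>M borel"
    unfolding real_digits_def
    by (rule measurable_compose[OF coordinate_measurable]) simp
qed

lemma null_set_outer_approximation:
  assumes N: "N \<in> null_sets cantor_measure"
  obtains U :: "nat \<Rightarrow> (nat \<Rightarrow> real) set"
  where "\<And>n. open (U n)" "N \<subseteq> real_digits -` (\<Inter>n. U n)"
    "real_digits -` (\<Inter>n. U n) \<in> null_sets cantor_measure"
proof -
  define M where "M = distr cantor_measure borel real_digits"
  interpret M: prob_space M
    unfolding M_def by (rule cantor.prob_space_distr[OF real_digits_measurable])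
  have sets_M: "sets M = sets borel"
    by (simp add: M_def)
  have emeasure_M: "emeasure M A = emeasure cantor_measure (real_digits -` A)"
    if "A \<in> sets borel" for A
    using that real_digits_measurable by (simp add: M_def emeasure_distr)
  define A where "A = {z :: nat \<Rightarrow> real. (\<lambda>n. z n = 1) \<in> N}"
  have A_N: "real_digits -` A = N"
    by (simp add: A_def real_digits_def)
  have "(\<lambda>z n. z n = 1) \<in> (borel :: (nat \<Rightarrow> real) measure) \<rightarrow>\<^sub>M cantor_measure"
    unfolding measurable_cong_sets[OF refl sets_cantor]
  proof (rule measurable_PiM_single')
    fix n
    have "(\<lambda>z :: nat \<Rightarrow> real. z n) \<in> borel \<rightarrow>\<^sub>M borel"
      by (rule measurable_product_then_coordinatewise) simp
    then show "(\<lambda>z :: nat \<Rightarrow> real. z n = 1) \<in> borel \<rightarrow>\<^sub>M count_space UNIV"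
      by measurable
  qed simp
  then have A_borel: "A \<in> sets borel"
    using measurable_sets[of _ borel cantor_measure N] N by (simp add: A_def vimage_def null_sets_def)
  have "(INF U\<in>{U. A \<subseteq> U \<and> open U}. emeasure M U) = 0"
    using outer_regular[OF sets_M _ A_borel] emeasure_M[OF A_borel] N
    by (simp add: A_N null_sets_def M.emeasure_space_1)
  then have "\<exists>U. A \<subseteq> U \<and> open U \<and> emeasure M U < ennreal (1 / Suc n)" for n
    using INF_less_iff[of "emeasure M" "{U. A \<subseteq> U \<and> open U}" "ennreal (1 / Suc n)"]
    by (auto simp: ennreal_less_zero_iff)
  then obtain U where U: "\<And>n. A \<subseteq> U n" "\<And>n. open (U n)"
      "\<And>n. emeasure M (U n) < ennreal (1 / Suc n)"
    by metis
  have Inter: "(\<Inter>n. U n) \<in> sets borel"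
    using U(2) by (intro sets.countable_INT) auto
  have "emeasure M (\<Inter>n. U n) = 0"
  proof -
    have "measure M (\<Inter>n. U n) \<le> 1 / Suc n" for n
    proof -
      have "measure M (\<Inter>n. U n) \<le> measure M (U n)"
        using U(2) by (intro M.finite_measure_mono) (auto simp: sets_M)
      also have "\<dots> \<le> 1 / Suc n"
        using U(3)[of n] by (simp add: M.emeasure_eq_measure ennreal_less_iff)
      finally show ?thesis .
    qed
    then have "measure M (\<Inter>n. U n) \<le> 0"
      by (intro LIMSEQ_le_const[OF LIMSEQ_inverse_real_of_nat])
        (auto simp: inverse_eq_divide)
    then show ?thesis
      by (simp add: M.emeasure_eq_measure ennreal_neg)
  qed
  then have "real_digits -` (\<Inter>n. U n) \<in> null_sets cantor_measure"
    using emeasure_M[OF Inter] measurable_sets[OF real_digits_measurable Inter]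
    by (simp add: null_sets_def)
  moreover have "N \<subseteq> real_digits -` (\<Inter>n. U n)"
    using U(1) A_N by blast
  ultimately show thesis
    using that U(2) by blast
qed

text \<open>A sequence of open sets is coded by the set of all \<open>(n, m)\<close> such that the basic open set
  with number \<open>m\<close> is part of the union that forms the \<open>n\<close>-th open set.\<close>
lemma null_sets_coded:
  obtains G :: "(nat \<Rightarrow> bool) \<Rightarrow> (nat \<Rightarrow> bool) set"
  where "\<And>c. G c \<in> null_ideal" "\<And>N. N \<in> null_ideal \<Longrightarrow> \<exists>c. N \<subseteq> G c"
proof -
  obtain B :: "(nat \<Rightarrow> real) set set" where B: "countable B" "topological_basis B"
    using ex_countable_basis by blast
  define U where "U c n = \<Union>{V \<in> B. \<exists>m. c (prod_encode (n, m)) \<and> V = from_nat_into B m}"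
    for c :: "nat \<Rightarrow> bool" and n
  define H where "H c = real_digits -` (\<Inter>n. U c n)" for c
  \<comment> \<open>Not every code yields a null set; the others are made to code the empty set.\<close>
  define G where "G c = (if H c \<in> null_ideal then H c else {})" for c
  show thesis
  proof
    show "G c \<in> null_ideal" for c
      by (simp add: G_def null_ideal_def)
  next
    fix N assume "N \<in> null_ideal"
    then obtain N' where N': "N' \<in> null_sets cantor_measure" "N \<subseteq> N'"
      using null_ideal_iff by blast
    obtain W :: "nat \<Rightarrow> (nat \<Rightarrow> real) set" where W: "\<And>n. open (W n)" "N' \<subseteq> real_digits -` (\<Inter>n. W n)"
      "real_digits -` (\<Inter>n. W n) \<in> null_sets cantor_measure"
      using null_set_outer_approximation[OF N'(1)] by blast
    have "\<exists>C. C \<subseteq> B \<and> \<Union>C = W n" for n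
      by (rule conjunct2[OF B(2)[unfolded topological_basis_def], rule_format, OF W(1)])
    then have "\<exists>C. \<forall>n. C n \<subseteq> B \<and> \<Union>(C n) = W n"
      by (intro choice allI)
    then obtain C where C: "\<And>n. C n \<subseteq> B" "\<And>n. \<Union>(C n) = W n"
      by blast
    define c where "c i = (case prod_decode i of (n, m) \<Rightarrow> from_nat_into B m \<in> C n)" for i
    have "{V \<in> B. \<exists>m. c (prod_encode (n, m)) \<and> V = from_nat_into B m} = C n" for n
    proof (intro set_eqI iffI)
      fix V assume V: "V \<in> C n"
      then have "V \<in> B"
        using C(1) by blast
      moreover from this obtain m where "from_nat_into B m = V"
        using from_nat_into_surj[OF B(1)] by blast
      ultimately show "V \<in> {V \<in> B. \<exists>m. c (prod_encode (n, m)) \<and> V = from_nat_into B m}"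
        using V by (auto simp: c_def)
    qed (auto simp: c_def)
    then have "U c n = W n" for n
      using C(2) by (simp add: U_def)
    then have H: "H c = real_digits -` (\<Inter>n. W n)"
      by (simp add: H_def)
    then have "H c \<in> null_ideal"
      using W(3) null_ideal_iff by auto
    then have "N \<subseteq> G c"
      using N'(2) W(2) H by (simp add: G_def)
    then show "\<exists>c. N \<subseteq> G c"
      by blast
  qed
qed

section \<open>The diagonal construction\<close>

lemma continuum_eq: "continuum = |UNIV :: (nat \<Rightarrow> bool) set|"
  by (simp add: cexp_def Field_natLeq ctwo_def Field_card_of Func_def)

lemma Union_in_ideal:
  assumes "\<G> \<subseteq> I" "|\<G>| <o additivity I"
  shows "\<Union>\<G> \<in> I"
  using additivity_least(2)[OF assms(1) _ assms(1)] assms(2) not_ordLess_ordLeq by blast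

lemma FSP_null_subtree:
  assumes "p \<in> FSP"
  obtains q where "q \<in> FSP" "q \<subseteq> p" "branches q \<in> null_ideal"
  using FSP_disjoint_subtrees[OF assms] disjoint_branches_null by metis

theorem proposition5p5:
  assumes "additivity null_ideal =o continuum"
  shows "I_FSP - null_ideal \<noteq> {}"
proof -
  define r where "r = |UNIV :: (nat \<Rightarrow> bool) set|"
  have r: "Card_order r" "Field r = UNIV" "total r"
    using card_of_Card_order card_of_well_order_on[of "UNIV :: (nat \<Rightarrow> bool) set"]
    by (simp_all add: r_def well_order_on_def linear_order_on_def Field_card_of)
  have underS_small: "|underS r a| <o r" for a
    using card_of_underS[OF r(1)] r(2) by simp
  obtain G :: "(nat \<Rightarrow> bool) \<Rightarrow> (nat \<Rightarrow> bool) set"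
    where G: "\<And>c. G c \<in> null_ideal" "\<And>N. N \<in> null_ideal \<Longrightarrow> \<exists>c. N \<subseteq> G c"
    using null_sets_coded by blast
  \<comment> \<open>Points of Cantor space also serve as indices of all sets of finite sequences.\<close>
  define P :: "(nat \<Rightarrow> bool) \<Rightarrow> bool list set" where "P a = {t. a (to_nat t)}" for a
  have P_surj: "\<exists>a. P a = p" for p
    by (rule exI[of _ "\<lambda>i. from_nat i \<in> p"]) (simp add: P_def)
  have "\<exists>q. branches q \<in> null_ideal \<and> (P a \<in> FSP \<longrightarrow> q \<in> FSP \<and> q \<subseteq> P a)" for a
  proof (cases "P a \<in> FSP")
    case True
    then show ?thesis
      using FSP_null_subtree by metis
  next
    case False
    have "branches {} \<in> null_ideal"
      by (simp add: branches_def null_ideal_def)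
    then show ?thesis
      using False by blast
  qed
  then obtain q where q: "\<And>a. branches (q a) \<in> null_ideal"
      "\<And>a. P a \<in> FSP \<Longrightarrow> q a \<in> FSP" "\<And>a. P a \<in> FSP \<Longrightarrow> q a \<subseteq> P a"
    by metis
  have "\<exists>x. x \<notin> G a \<union> branches (q a) \<union> \<Union>((\<lambda>b. branches (q b)) ` underS r a)" for a
  proof -
    have "|(\<lambda>b. branches (q b)) ` underS r a| <o additivity null_ideal"
      using ordLess_ordIso_trans[OF ordLeq_ordLess_trans[OF card_of_image underS_small]]
        ordIso_symmetric[OF assms] unfolding continuum_eq r_def[symmetric] by blast
    then have "\<Union>((\<lambda>b. branches (q b)) ` underS r a) \<in> null_ideal"
      using q(1) by (intro Union_in_ideal) auto
    then show ?thesis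
      using null_ideal_Un G(1) q(1) UNIV_not_null by (metis UNIV_eq_I)
  qed
  then obtain x where x: "\<And>a. x a \<notin> G a" "\<And>a. x a \<notin> branches (q a)"
      "\<And>a b. b \<in> underS r a \<Longrightarrow> x a \<notin> branches (q b)"
    by (metis (mono_tags, lifting) UN_I UnCI)
  have "range x \<notin> null_ideal"
    using G(2) x(1) by blast
  moreover have "FSP_nowhere_dense (range x)"
    unfolding FSP_nowhere_dense_def
  proof
    fix p assume "p \<in> FSP"
    then obtain a where a: "P a = p" "P a \<in> FSP"
      using P_surj by metis
    obtain Q :: "(nat \<Rightarrow> bool) \<Rightarrow> bool list set" where
      Q: "\<And>f. Q f \<in> FSP" "\<And>f. Q f \<subseteq> q a" "disjoint_family (\<lambda>f. branches (Q f))"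
      using FSP_disjoint_subtrees[OF q(2)[OF a(2)]] by blast
    have "\<exists>f. branches (Q f) \<inter> range x = {}"
    proof (rule ccontr)
      assume "\<not> ?thesis"
      then have "\<forall>f. \<exists>b. x b \<in> branches (Q f)"
        by blast
      then obtain e where e: "\<And>f. x (e f) \<in> branches (Q f)"
        by metis
      \<comment> \<open>Continuum many disjoint sets would each need their own point of \<open>X\<close>, but only the
          points with an index below \<open>a\<close> can be branches of \<open>q a\<close>.\<close>
      have "inj e"
        using e Q(3) unfolding disjoint_family_on_def inj_def by (metis IntI UNIV_I empty_iff)
      moreover have "e f \<in> underS r a" for f
      proof -
        have "x (e f) \<in> branches (q a)"
          using e[of f] Q(2)[of f] unfolding branches_def by blast
        then have "e f \<noteq> a" "a \<notin> underS r (e f)"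
          using x(2,3) by blast+
        then show ?thesis
          using r(2,3) unfolding underS_def total_on_def by auto
      qed
      ultimately have "r \<le>o |underS r a|"
        unfolding r_def by (metis card_of_ordLeq image_subsetI)
      then show False
        using underS_small not_ordLess_ordLeq by blast
    qed
    then show "\<exists>q\<in>FSP. q \<subseteq> p \<and> branches q \<inter> range x = {}"
      using Q(1,2) q(3)[OF a(2)] a(1) by blast
  qed
  then have "range x \<in> I_FSP"
    unfolding I_FSP_def by (auto intro!: exI[of _ "{range x}"])
  ultimately show ?thesis
    by blast
qed

end
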